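(* Let $\alpha_i,d_i\in\mathbb{R}$, $i=1,2,3$, and consider the system in $\mathbb{R}^3$ $$\begin{cases} \frac{dx_1}{dt}=x_1\big(\alpha_1-\alpha_1x_1^2-(\alpha_1+\alpha_2+d_1)x_2^2+d_2x_3^2\big),\\ \frac{dx_2}{dt}=x_2\big(\alpha_2+d_1x_1^2-\alpha_2x_2^2-(\alpha_2+\alpha_3+d_3)x_3^2\big),\\ \frac{dx_3}{dt}=x_3\big(\alpha_3-(\alpha_3+\alpha_1+d_2)x_1^2+d_3x_2^2-\alpha_3x_3^2\big), \end{cases}$$ for which the unit sphere $\mathbb{S}^2$ is invariant. The invariant sphere $\mathbb{S}^2$ is a global attractor of this system in $\mathbb{R}^3\setminus\{O\}$ if and only if $\alpha_i>0$ for $i=1,2,3$.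
   Context: $\mathbb{S}^2=\{(x_1,x_2,x_3)\in\mathbb{R}^3: x_1^2+x_2^2+x_3^2=1\}$ and $O=(0,0,0)$. The compact invariant set $\mathbb{S}^2$ is a global attractor in $\mathbb{R}^3\setminus\{O\}$ if for every $x_0\in\mathbb{R}^3\setminus\{O\}$ the forward solution starting at $x_0$ exists for all $t\ge 0$ and converges to $\mathbb{S}^2$, i.e. its (nonempty) $\omega$-limit set is contained in $\mathbb{S}^2$. *)

theory Defs
  imports "HOL-Analysis.Analysis"
begin

text \<open>\<^term>\<open>solves_ode_on f J x\<close>: \<^term>\<open>x\<close> solves the autonomous equation \<open>x' = f x\<close> on the
  time set \<^term>\<open>J\<close>, with one-sided derivatives at end points belonging to \<^term>\<open>J\<close>.\<close>

definition solves_ode_on ::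
    "('a::real_normed_vector \<Rightarrow> 'a) \<Rightarrow> real set \<Rightarrow> (real \<Rightarrow> 'a) \<Rightarrow> bool" where
  "solves_ode_on f J x \<longleftrightarrow> (\<forall>t\<in>J. (x has_vector_derivative f (x t)) (at t within J))"

text \<open>Invariance in forward and backward time: a solution on any interval that meets the set
  stays in it.\<close>

definition invariant_set :: "('a::real_normed_vector \<Rightarrow> 'a) \<Rightarrow> 'a set \<Rightarrow> bool" where
  "invariant_set f S \<longleftrightarrow>
     (\<forall>J x. is_interval J \<and> solves_ode_on f J x \<and> (\<exists>s\<in>J. x s \<in> S) \<longrightarrow> (\<forall>t\<in>J. x t \<in> S))"

definition omega_limit :: "(real \<Rightarrow> 'a::topological_space) \<Rightarrow> 'a set" where
  "omega_limit x =
     {p. \<exists>\<tau>::nat \<Rightarrow> real. filterlim \<tau> at_top sequentially \<and> (\<lambda>n. x (\<tau> n)) \<longlonglongrightarrow> p}"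

text \<open>Intended for a compact invariant set \<^term>\<open>S\<close> and a locally Lipschitz field \<^term>\<open>f\<close>.
  Forward solutions are then unique, so requiring existence together with the limit property of
  all solutions from \<^term>\<open>x0\<close> says just that the solution from \<^term>\<open>x0\<close> is global and
  converges to \<^term>\<open>S\<close>.\<close>

definition global_attractor_in :: "('a::real_normed_vector \<Rightarrow> 'a) \<Rightarrow> 'a set \<Rightarrow> 'a set \<Rightarrow> bool" where
  "global_attractor_in f S U \<longleftrightarrow>
     (\<forall>x0\<in>U.
        (\<exists>x. solves_ode_on f {0..} x \<and> x 0 = x0) \<and>
        (\<forall>x. solves_ode_on f {0..} x \<and> x 0 = x0 \<longrightarrow>
             omega_limit x \<noteq> {} \<and> omega_limit x \<subseteq> S))"

definition sphere_field :: "real^3 \<Rightarrow> real^3 \<Rightarrow> real^3 \<Rightarrow> real^3" where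
  "sphere_field \<alpha> d x = vector
     [x$1 * (\<alpha>$1 - \<alpha>$1 * (x$1)\<^sup>2 - (\<alpha>$1 + \<alpha>$2 + d$1) * (x$2)\<^sup>2 + d$2 * (x$3)\<^sup>2),
      x$2 * (\<alpha>$2 + d$1 * (x$1)\<^sup>2 - \<alpha>$2 * (x$2)\<^sup>2 - (\<alpha>$2 + \<alpha>$3 + d$3) * (x$3)\<^sup>2),
      x$3 * (\<alpha>$3 - (\<alpha>$3 + \<alpha>$1 + d$2) * (x$1)\<^sup>2 + d$3 * (x$2)\<^sup>2 - \<alpha>$3 * (x$3)\<^sup>2)]"

end

theory Submission
  imports Defs
begin

text \<open>Put \<open>A = \<Sum>\<alpha>\<^sub>i x\<^sub>i\<^sup>2\<close>. The cross terms of the system cancel in \<open>x \<bullet> f x\<close>, so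
  \<open>u = 1 - |x|\<^sup>2\<close> satisfies the linear equation \<open>u' = - 2 A u\<close> along solutions. Hence the sphere is
  invariant. If all \<open>\<alpha>\<^sub>i\<close> are positive, \<open>|x|\<^sup>2\<close> stays above \<open>min 1 |x(0)|\<^sup>2\<close>, so \<open>A\<close> is bounded
  below and \<open>u\<close> decays exponentially. If \<open>\<alpha>\<^sub>i \<le> 0\<close>, the invariant \<open>i\<close>-th axis carries a solution
  starting at distance \<open>1/2\<close> from the origin along which \<open>A \<le> 0\<close>, so \<open>|u|\<close> does not decrease.\<close>

section \<open>Global solutions for globally Lipschitz fields\<close>

lemma has_vector_derivative_within_atLeast:
  fixes x :: "real \<Rightarrow> 'a::real_normed_vector"
  assumes "0 \<le> t" "t < b"
  shows "(x has_vector_derivative D) (at t within {0..b}) \<longleftrightarrow>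
         (x has_vector_derivative D) (at t within {0..})"
proof -
  have "at t within {0..b} = at t within {0..}"
    by (rule at_within_nhd[of _ "{..<b}"]) (use assms in auto)
  then show ?thesis by simp
qed

lemma integral_has_vector_derivative_atLeast:
  fixes h :: "real \<Rightarrow> 'a::banach"
  assumes "continuous_on {0..} h" "0 \<le> t"
  shows "((\<lambda>u. integral {0..u} h) has_vector_derivative h t) (at t within {0..})"
proof -
  have "((\<lambda>u. integral {0..u} h) has_vector_derivative h t) (at t within {0..t+1})"
    by (rule integral_has_vector_derivative)
      (use assms in \<open>auto intro: continuous_on_subset\<close>)
  then show ?thesis
    using has_vector_derivative_within_atLeast[of t "t+1"] assms by auto
qed

lemma integral_exp_scaled:
  fixes c t :: real
  assumes "0 < c" "0 \<le> t"
  shows "((\<lambda>s. exp (c * s)) has_integral (exp (c * t) - 1) / c) {0..t}"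
proof -
  have "((\<lambda>s. exp (c * s)) has_integral exp (c * t) / c - exp (c * 0) / c) {0..t}"
    using assms
    by (intro fundamental_theorem_of_calculus)
      (auto simp: has_real_derivative_iff_has_vector_derivative[symmetric]
        intro!: derivative_eq_intros)
  then show ?thesis by (simp add: diff_divide_distrib)
qed

text \<open>Integrating \<open>exp (c * s)\<close> gains a factor \<open>1 / c\<close> and the
  weight \<open>exp (- (c * t))\<close> removes the growth, so the bound is uniform in
  \<open>t\<close>. It serves twice below: for boundedness of the Picard iterate and for
  contraction.\<close>

lemma norm_integral_exp_le:
  fixes h :: "real \<Rightarrow> 'a::banach"
  assumes "continuous_on {0..t} h" "0 < c" "0 \<le> t" "0 \<le> K"
    and bound: "\<And>s. 0 \<le> s \<Longrightarrow> s \<le> t \<Longrightarrow> norm (h s) \<le> K * exp (c * s)"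
  shows "exp (- (c * t)) * norm (integral {0..t} h) \<le> K / c"
proof -
  have E: "((\<lambda>s. K * exp (c * s)) has_integral K * ((exp (c * t) - 1) / c)) {0..t}"
    using integral_exp_scaled[of c t] assms by (intro has_integral_mult_right)
  have "norm (integral {0..t} h) \<le> integral {0..t} (\<lambda>s. K * exp (c * s))"
    by (rule integral_norm_bound_integral)
      (use assms E in \<open>auto intro: integrable_continuous_real has_integral_integrable\<close>)
  also have "\<dots> = K * ((exp (c * t) - 1) / c)"
    using E by (rule integral_unique)
  also have "\<dots> \<le> K * (exp (c * t) / c)"
    using assms by (intro mult_left_mono divide_right_mono) auto
  finally have "exp (- (c * t)) * norm (integral {0..t} h) \<le> exp (- (c * t)) * (K * (exp (c * t) / c))"
    by (intro mult_left_mono) auto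
  also have "\<dots> = K / c"
    by (simp add: exp_minus field_simps)
  finally show ?thesis .
qed

text \<open>The Picard operator on \<open>y t = exp (- c t) x t\<close> is a contraction of the bounded continuous
  functions once \<open>c\<close> exceeds the Lipschitz constant. Functions on \<open>{0..}\<close> are encoded as functions
  on the line that are constant on \<open>{..0}\<close>.\<close>

lemma lipschitz_global_solution:
  fixes g :: "'a::banach \<Rightarrow> 'a"
  assumes lip: "L-lipschitz_on UNIV g"
  shows "\<exists>x. solves_ode_on g {0..} x \<and> x 0 = x0"
proof -
  \<comment> \<open>This choice gives both \<open>0 < c\<close>, even when \<open>L = 0\<close>, and
    \<open>L / c < 1\<close>.\<close>
  define c where "c = 2 * L + 1"
  have L0: "0 \<le> L" using lip by (rule lipschitz_on_nonneg)
  then have c: "0 < c" by (simp add: c_def)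
  have gc: "continuous_on S g" for S
    using lipschitz_on_continuous_on[OF lip] continuous_on_subset by blast
  \<comment> \<open>Multiplying by \<open>exp (c * s)\<close> undoes the weight, so
    \<open>h y\<close> is the integrand \<open>g (x s)\<close> of the Picard integral.\<close>
  define h where "h y s = g (exp (c * s) *\<^sub>R apply_bcontfun y s)" for y :: "real \<Rightarrow>\<^sub>C 'a" and s
  have hc: "continuous_on S (h y)" for S y
    unfolding h_def by (rule continuous_on_compose2[OF gc]) (auto intro!: continuous_intros)
  define F where "F y t = exp (- (c * max 0 t)) *\<^sub>R (x0 + integral {0..max 0 t} (h y))" for y and t :: real
  have "F y \<in> bcontfun" for y
  proof (rule bcontfun_normI)
    have "continuous_on {0..} (\<lambda>t. integral {0..t} (h y))"
      using integral_has_vector_derivative_atLeast[OF hc]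
      by (auto simp: continuous_on_eq_continuous_within intro: has_vector_derivative_continuous)
    then have "continuous_on UNIV (\<lambda>t. integral {0..max 0 t} (h y))"
      by (rule continuous_on_compose2) (auto intro!: continuous_intros)
    then show "continuous_on UNIV (F y)"
      unfolding F_def by (intro continuous_intros continuous_on_max)
  next
    fix t :: real
    define m where "m = max 0 t"
    have m: "0 \<le> m" by (simp add: m_def)
    \<comment> \<open>Comparison with \<open>g 0\<close> gives linear growth; the constant term is
      absorbed because \<open>exp (c * s)\<close> is at least 1 for nonnegative
      \<open>s\<close>.\<close>
    have "norm (h y s) \<le> (norm (g 0) + L * norm y) * exp (c * s)" if "0 \<le> s" for s
    proof -
      have "norm (h y s) \<le> norm (g 0) + norm (h y s - g 0)"
        by (metis add.commute diff_add_cancel norm_triangle_ineq)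
      also have "norm (h y s - g 0) \<le> L * (exp (c * s) * norm (apply_bcontfun y s))"
        using lipschitz_on_normD[OF lip, of "exp (c * s) *\<^sub>R apply_bcontfun y s" 0] by (simp add: h_def)
      also have "\<dots> \<le> L * (exp (c * s) * norm y)"
        using L0 by (intro mult_left_mono norm_bounded) auto
      also have "norm (g 0) + \<dots> \<le> norm (g 0) * exp (c * s) + L * (exp (c * s) * norm y)"
        using c that by (simp add: mult_le_cancel_left1)
      finally show ?thesis by (simp add: algebra_simps)
    qed
    then have *: "exp (- (c * m)) * norm (integral {0..m} (h y)) \<le> (norm (g 0) + L * norm y) / c"
      using c m L0 by (intro norm_integral_exp_le hc) auto
    have "norm (F y t) \<le> exp (- (c * m)) * (norm x0 + norm (integral {0..m} (h y)))"
      unfolding F_def m_def by (simp add: norm_triangle_ineq)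
    also have "\<dots> \<le> 1 * norm x0 + (norm (g 0) + L * norm y) / c"
      using * c m by (simp add: distrib_left add_mono mult_left_le_one_le)
    finally show "norm (F y t) \<le> 1 * norm x0 + (norm (g 0) + L * norm y) / c" .
  qed
  then have F: "apply_bcontfun (Bcontfun (F y)) = F y" for y
    by (simp add: Bcontfun_inverse)
  have "\<exists>!y. Bcontfun (F y) = y"
  proof (rule banach_fix_type)
    show "0 \<le> L / c" "L / c < 1" using L0 c by (auto simp: c_def field_simps)
    show "\<forall>y z. dist (Bcontfun (F y)) (Bcontfun (F z)) \<le> L / c * dist y z"
    proof (intro allI dist_bound)
      fix y z and t :: real
      define m where "m = max 0 t"
      have m: "0 \<le> m" by (simp add: m_def)
      have "norm (h y s - h z s) \<le> (L * dist y z) * exp (c * s)" for s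
      proof -
        have "norm (h y s - h z s) \<le> L * dist (exp (c * s) *\<^sub>R apply_bcontfun y s) (exp (c * s) *\<^sub>R apply_bcontfun z s)"
          using lipschitz_onD[OF lip] by (simp add: h_def dist_norm)
        also have "\<dots> = L * (exp (c * s) * dist (apply_bcontfun y s) (apply_bcontfun z s))"
          by (simp add: dist_norm flip: scaleR_diff_right)
        also have "\<dots> \<le> L * (exp (c * s) * dist y z)"
          using L0 by (intro mult_left_mono dist_bounded) auto
        finally show ?thesis by (simp add: algebra_simps)
      qed
      then have "exp (- (c * m)) * norm (integral {0..m} (\<lambda>s. h y s - h z s)) \<le> L * dist y z / c"
        using c m L0 by (intro norm_integral_exp_le continuous_intros hc) auto
      moreover have "integral {0..m} (\<lambda>s. h y s - h z s) = integral {0..m} (h y) - integral {0..m} (h z)"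
        by (intro integral_diff integrable_continuous_real hc)
      moreover have "F y t - F z t = exp (- (c * m)) *\<^sub>R (integral {0..m} (h y) - integral {0..m} (h z))"
        unfolding F_def m_def by (simp add: algebra_simps)
      ultimately show "dist (apply_bcontfun (Bcontfun (F y)) t) (apply_bcontfun (Bcontfun (F z)) t)
          \<le> L / c * dist y z"
        unfolding F by (simp add: dist_norm)
    qed
  qed
  then obtain y where "Bcontfun (F y) = y" by blast
  then have y: "apply_bcontfun y t = F y t" for t using F by metis
  \<comment> \<open>For nonnegative \<open>t\<close> this is the fixed point with its weight
    removed; the integral form makes the derivative immediate.\<close>
  define x where "x t = x0 + integral {0..t} (h y)" for t
  have hx: "h y t = g (x t)" if "0 \<le> t" for t
    using that by (simp add: h_def y F_def x_def exp_minus)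
  have "(x has_vector_derivative 0 + h y t) (at t within {0..})" if "0 \<le> t" for t
    unfolding x_def[abs_def]
    by (intro has_vector_derivative_add has_vector_derivative_const
        integral_has_vector_derivative_atLeast hc that)
  moreover have "x 0 = x0" by (simp add: x_def)
  ultimately show ?thesis unfolding solves_ode_on_def by (auto simp: hx)
qed

section \<open>Scalar differential equations and inequalities\<close>

text \<open>Integrating factor: \<open>w t * exp (- G t)\<close> has derivative zero, where
  \<open>G\<close> is the primitive of \<open>a\<close> vanishing at \<open>p\<close>.\<close>

lemma linear_ode_solution:
  fixes w a :: "real \<Rightarrow> real"
  assumes "p \<le> q" and a: "continuous_on {p..q} a"
    and w: "\<And>t. t \<in> {p..q} \<Longrightarrow> (w has_real_derivative a t * w t) (at t within {p..q})"
  shows "w q = w p * exp (integral {p..q} a)"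
proof -
  define G where "G t = integral {p..t} a" for t
  have G: "(G has_real_derivative a t) (at t within {p..q})" if "t \<in> {p..q}" for t
    using integral_has_vector_derivative[OF a that]
    by (simp add: has_real_derivative_iff_has_vector_derivative G_def[abs_def])
  have "\<exists>k. \<forall>t\<in>{p..q}. w t * exp (- G t) = k"
  proof (rule has_field_derivative_zero_constant)
    show "((\<lambda>t. w t * exp (- G t)) has_real_derivative 0) (at t within {p..q})"
      if "t \<in> {p..q}" for t
      using w[OF that] G[OF that] by (auto intro!: derivative_eq_intros)
  qed auto
  then have "w q * exp (- G q) = w p * exp (- G p)"
    using \<open>p \<le> q\<close> by (metis atLeastAtMost_iff order_refl)
  then show ?thesis by (simp add: G_def exp_minus field_simps)
qed

text \<open>The explicit formula works in both time directions, since the exponential factor never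
  vanishes.\<close>

lemma linear_ode_zero:
  fixes w a :: "real \<Rightarrow> real"
  assumes "is_interval J" and a: "continuous_on J a"
    and w: "\<And>t. t \<in> J \<Longrightarrow> (w has_real_derivative a t * w t) (at t within J)"
    and "s \<in> J" "t \<in> J" "w s = 0"
  shows "w t = 0"
proof -
  have *: "w q = w p * exp (integral {p..q} a)" if "p \<le> q" "p \<in> J" "q \<in> J" for p q
  proof (rule linear_ode_solution)
    have "{p..q} \<subseteq> J"
      using \<open>p \<in> J\<close> \<open>q \<in> J\<close> \<open>is_interval J\<close> unfolding is_interval_1 by fastforce
    then show "continuous_on {p..q} a"
      "\<And>t. t \<in> {p..q} \<Longrightarrow> (w has_real_derivative a t * w t) (at t within {p..q})"
      using a w by (blast intro: continuous_on_subset DERIV_subset)+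
  qed fact
  show ?thesis
    using *[of s t] *[of t s] \<open>s \<in> J\<close> \<open>t \<in> J\<close> \<open>w s = 0\<close> by (cases "s \<le> t") auto
qed

text \<open>If \<open>v\<close> exceeded \<open>c\<close> at time \<open>t\<close>, it would have
  risen from its last earlier visit to \<open>{..c}\<close>; but it stays above \<open>c\<close> in
  between, where its derivative is nonpositive.\<close>

lemma barrier_bound:
  fixes v :: "real \<Rightarrow> real"
  assumes v: "\<And>t. 0 \<le> t \<Longrightarrow> (v has_real_derivative v' t) (at t within {0..})"
    and neg: "\<And>t. 0 \<le> t \<Longrightarrow> c < v t \<Longrightarrow> v' t \<le> 0"
    and "v 0 \<le> c" "0 \<le> t"
  shows "v t \<le> c"
proof (rule ccontr)
  assume t: "\<not> v t \<le> c"
  define S where "S = {0..t} \<inter> v -` {..c}"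
  have "continuous_on {0..} v"
    unfolding continuous_on_eq_continuous_within using v DERIV_continuous by fastforce
  then have vc: "continuous_on {0..t} v"
    by (rule continuous_on_subset) auto
  have "closed S"
    unfolding S_def by (rule continuous_closed_preimage[OF vc]) auto
  moreover have S: "bdd_above S" "S \<noteq> {}"
    using assms unfolding S_def by (auto intro!: bdd_aboveI[of _ t])
  ultimately have s: "Sup S \<in> S" by (simp add: closed_contains_Sup)
  then have s': "0 \<le> Sup S" "Sup S < t" "v (Sup S) \<le> c"
    using t unfolding S_def by (auto simp: less_le)
  \<comment> \<open>\<open>Sup S\<close> is the last time up to \<open>t\<close> with
    \<open>v\<close> at most \<open>c\<close>, so the mean value point \<open>r\<close> lies where
    the sign condition holds.\<close>
  have "\<exists>r\<in>{Sup S<..<t}. v t - v (Sup S) = v' r * (t - Sup S)"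
  proof (rule mvt_simple)
    show "(v has_derivative (*) (v' r)) (at r within {Sup S..t})"
      if "Sup S \<le> r" "r \<le> t" for r
      using v[of r] that s' unfolding has_field_derivative_def[symmetric]
      by (auto intro: DERIV_subset)
  qed fact
  then obtain r where r: "Sup S < r" "r < t" and eq: "v t - v (Sup S) = v' r * (t - Sup S)"
    by auto
  have "r \<notin> S" using r S cSup_upper by (metis not_le)
  then have "v' r \<le> 0" using r s' by (intro neg) (auto simp: S_def)
  then have "v t \<le> v (Sup S)"
    using eq s' by (smt (verit) mult_nonpos_nonneg)
  then show False using t s' by simp
qed

section \<open>The sphere field\<close>

definition weighted_square :: "real^3 \<Rightarrow> real^3 \<Rightarrow> real" where
  "weighted_square \<alpha> x = (\<Sum>i\<in>UNIV. \<alpha>$i * (x$i)\<^sup>2)"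

lemma inner_sphere_field:
  "x \<bullet> sphere_field \<alpha> d x = weighted_square \<alpha> x * (1 - x \<bullet> x)"
  by (simp add: inner_vec_def sphere_field_def weighted_square_def sum_3 power2_eq_square
      algebra_simps)

lemma weighted_square_ge:
  assumes "\<And>i. m \<le> \<alpha>$i"
  shows "m * (x \<bullet> x) \<le> weighted_square \<alpha> x"
  unfolding weighted_square_def inner_vec_def sum_distrib_left
  by (intro sum_mono) (simp add: assms mult_right_mono power2_eq_square)

lemma continuous_on_weighted_square [continuous_intros]:
  "continuous_on S x \<Longrightarrow> continuous_on S (\<lambda>t. weighted_square \<alpha> (x t))"
  unfolding weighted_square_def by (intro continuous_intros)

lemma solves_ode_on_continuous: "solves_ode_on f J x \<Longrightarrow> continuous_on J x"
  unfolding solves_ode_on_def continuous_on_eq_continuous_within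
  using has_vector_derivative_continuous by blast

lemma solves_ode_on_subset: "solves_ode_on f J x \<Longrightarrow> I \<subseteq> J \<Longrightarrow> solves_ode_on f I x"
  unfolding solves_ode_on_def by (blast intro: has_vector_derivative_within_subset)

lemma solves_ode_on_inner:
  assumes "solves_ode_on f J (x :: real \<Rightarrow> 'a::real_inner)" "t \<in> J"
  shows "((\<lambda>t. x t \<bullet> x t) has_real_derivative 2 * (x t \<bullet> f (x t))) (at t within J)"
proof -
  have "(x has_derivative (\<lambda>h. h *\<^sub>R f (x t))) (at t within J)"
    using assms by (auto simp: solves_ode_on_def has_vector_derivative_def)
  from has_derivative_inner[OF this this] show ?thesis
    unfolding has_field_derivative_def
    by (rule has_derivative_eq_rhs) (auto simp: inner_commute algebra_simps)
qed

lemma one_minus_inner_derivative: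
  assumes "solves_ode_on (sphere_field \<alpha> d) J x" "t \<in> J"
  shows "((\<lambda>t. 1 - x t \<bullet> x t) has_real_derivative
    (- 2 * weighted_square \<alpha> (x t)) * (1 - x t \<bullet> x t)) (at t within J)"
  using solves_ode_on_inner[OF assms]
  by (auto simp: inner_sphere_field intro!: derivative_eq_intros)

lemma mem_unit_sphere_iff: "x \<in> sphere 0 1 \<longleftrightarrow> x \<bullet> x = (1::real)" for x :: "'a::real_inner"
  by (simp add: norm_eq_sqrt_inner)

lemma sphere_field_invariant: "invariant_set (sphere_field \<alpha> d) (sphere 0 1)"
  unfolding invariant_set_def
proof (intro allI impI ballI, elim conjE bexE)
  fix J x s t
  assume J: "is_interval J" and x: "solves_ode_on (sphere_field \<alpha> d) J x"
    and s: "s \<in> J" "x s \<in> sphere 0 1" and t: "t \<in> J"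
  have "1 - x t \<bullet> x t = 0"
  proof (rule linear_ode_zero[OF J _ one_minus_inner_derivative[OF x] s(1) t])
    show "continuous_on J (\<lambda>t. - 2 * weighted_square \<alpha> (x t))"
      using solves_ode_on_continuous[OF x] by (intro continuous_intros)
  qed (use s mem_unit_sphere_iff in auto)
  then show "x t \<in> sphere 0 1" unfolding mem_unit_sphere_iff by simp
qed

lemma one_minus_inner_eq:
  assumes "solves_ode_on (sphere_field \<alpha> d) {0..} x" "0 \<le> t"
  shows "1 - x t \<bullet> x t =
    (1 - x 0 \<bullet> x 0) * exp (integral {0..t} (\<lambda>s. - 2 * weighted_square \<alpha> (x s)))"
proof (rule linear_ode_solution[OF \<open>0 \<le> t\<close>])
  have x: "solves_ode_on (sphere_field \<alpha> d) {0..t} x"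
    using assms by (auto intro: solves_ode_on_subset)
  show "continuous_on {0..t} (\<lambda>s. - 2 * weighted_square \<alpha> (x s))"
    using solves_ode_on_continuous[OF x] by (intro continuous_intros)
  show "((\<lambda>t. 1 - x t \<bullet> x t) has_real_derivative
      (- 2 * weighted_square \<alpha> (x s)) * (1 - x s \<bullet> x s)) (at s within {0..t})"
    if "s \<in> {0..t}" for s
    using one_minus_inner_derivative[OF x that] .
qed

section \<open>Necessity\<close>

text \<open>Each component of the field is divisible by its own coordinate. With a continuous
  cofactor \<open>b\<close>, the coordinate solves a scalar linear equation along any solution,
  which makes the coordinate planes invariant.\<close>

lemma sphere_field_component:
  obtains b where "\<And>S x. continuous_on S (x::real\<Rightarrow>_) \<Longrightarrow> continuous_on S (\<lambda>t. b (x t))"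
    and "\<And>x. sphere_field \<alpha> d x $ i = b x * x $ i"
proof -
  define b where "b x = (if i = 1 then \<alpha>$1 - \<alpha>$1 * (x$1)\<^sup>2 - (\<alpha>$1 + \<alpha>$2 + d$1) * (x$2)\<^sup>2 + d$2 * (x$3)\<^sup>2
    else if i = 2 then \<alpha>$2 + d$1 * (x$1)\<^sup>2 - \<alpha>$2 * (x$2)\<^sup>2 - (\<alpha>$2 + \<alpha>$3 + d$3) * (x$3)\<^sup>2
    else \<alpha>$3 - (\<alpha>$3 + \<alpha>$1 + d$2) * (x$1)\<^sup>2 + d$3 * (x$2)\<^sup>2 - \<alpha>$3 * (x$3)\<^sup>2)" for x :: "real^3"
  have "sphere_field \<alpha> d x $ i = b x * x $ i" for x
    using exhaust_3[of i] by (auto simp: b_def sphere_field_def)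
  moreover have "continuous_on S (\<lambda>t. b (x t))" if "continuous_on S x" for S and x :: "real \<Rightarrow> _"
    unfolding b_def using that
    by (cases "i = 1"; cases "i = 2") (auto intro!: continuous_intros)
  ultimately show ?thesis using that by blast
qed

lemma sphere_field_component_zero:
  assumes x: "solves_ode_on (sphere_field \<alpha> d) {0..} x" and "x 0 $ i = 0" "0 \<le> t"
  shows "x t $ i = 0"
proof -
  obtain b where b: "\<And>S x. continuous_on S (x::real\<Rightarrow>_) \<Longrightarrow> continuous_on S (\<lambda>t. b (x t))"
    and f: "\<And>x. sphere_field \<alpha> d x $ i = b x * x $ i"
    using sphere_field_component[of \<alpha> d i] by blast
  show ?thesis
  proof (rule linear_ode_zero[of "{0..}" "\<lambda>t. b (x t)" "\<lambda>t. x t $ i" 0])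
    show "((\<lambda>t. x t $ i) has_real_derivative b (x s) * x s $ i) (at s within {0..})"
      if "s \<in> {0..}" for s
      unfolding f[symmetric] has_real_derivative_iff_has_vector_derivative
      using x that bounded_linear.has_vector_derivative[OF bounded_linear_vec_nth]
      unfolding solves_ode_on_def by blast
  qed (use assms solves_ode_on_continuous[OF x] b in \<open>auto simp: is_interval_ci\<close>)
qed

lemma omega_limit_inner:
  fixes x :: "real \<Rightarrow> 'a::real_inner"
  assumes "p \<in> omega_limit x"
  obtains \<tau> where "filterlim \<tau> at_top sequentially"
    and "(\<lambda>n. x (\<tau> n) \<bullet> x (\<tau> n)) \<longlonglongrightarrow> p \<bullet> p"
proof -
  obtain \<tau> where "filterlim \<tau> at_top sequentially" and "(\<lambda>n. x (\<tau> n)) \<longlonglongrightarrow> p"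
    using assms unfolding omega_limit_def by blast
  then show ?thesis using that tendsto_inner by blast
qed

lemma attractor_imp_pos:
  assumes attr: "global_attractor_in (sphere_field \<alpha> d) (sphere 0 1) (UNIV - {0})"
  shows "0 < \<alpha> $ i"
proof (rule ccontr)
  assume neg: "\<not> 0 < \<alpha> $ i"
  \<comment> \<open>A point on the \<open>i\<close>-th axis strictly inside the ball; its squared
    norm is 1/4.\<close>
  define x0 :: "real^3" where "x0 = axis i (1/2)"
  have "x0 \<in> UNIV - {0}" by (simp add: x0_def axis_eq_0_iff)
  then obtain x p where x: "solves_ode_on (sphere_field \<alpha> d) {0..} x" and x0: "x 0 = x0"
    and p: "p \<in> omega_limit x" "p \<in> sphere 0 1"
    using attr unfolding global_attractor_in_def by blast
  \<comment> \<open>The coordinates other than \<open>i\<close> stay zero, so only the term with the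
    nonpositive weight survives.\<close>
  have "weighted_square \<alpha> (x t) \<le> 0" if "0 \<le> t" for t
    unfolding weighted_square_def
  proof (rule sum_nonpos)
    fix j :: 3
    have "x t $ j = 0" if "j \<noteq> i"
      using sphere_field_component_zero[OF x, of j t] \<open>0 \<le> t\<close> that
      by (simp add: x0 x0_def axis_def)
    then show "\<alpha> $ j * (x t $ j)\<^sup>2 \<le> 0"
      using neg by (cases "j = i") (auto simp: mult_nonpos_nonneg)
  qed
  then have "0 \<le> integral {0..t} (\<lambda>s. - 2 * weighted_square \<alpha> (x s))" for t
    using solves_ode_on_continuous[OF x]
    by (intro integral_nonneg integrable_continuous_real continuous_intros)
      (auto intro: continuous_on_subset)
  moreover have "x 0 \<bullet> x 0 = 1/4"
    by (simp add: x0 x0_def inner_axis_axis)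
  \<comment> \<open>The initial value of this quantity is 3/4, and it is multiplied by the
    exponential of a nonnegative number. Hence the solution cannot come closer to the
    sphere.\<close>
  moreover have "1 - x t \<bullet> x t \<ge> 3/4 * 1" if "0 \<le> t" for t
    unfolding one_minus_inner_eq[OF x that]
    by (rule mult_mono) (use calculation in simp_all)
  ultimately have le: "x t \<bullet> x t \<le> 1/4" if "0 \<le> t" for t
    using that by fastforce
  obtain \<tau> where \<tau>: "filterlim \<tau> at_top sequentially"
    and lim: "(\<lambda>n. x (\<tau> n) \<bullet> x (\<tau> n)) \<longlonglongrightarrow> p \<bullet> p"
    using omega_limit_inner[OF p(1)] by blast
  have "\<forall>\<^sub>F n in sequentially. x (\<tau> n) \<bullet> x (\<tau> n) \<le> 1/4"
    using filterlim_at_top[THEN iffD1, OF \<tau>, rule_format, of 0]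
    by eventually_elim (rule le)
  then have "p \<bullet> p \<le> 1/4"
    using lim by (intro tendsto_upperbound) auto
  then show False using p(2) unfolding mem_unit_sphere_iff by simp
qed

section \<open>Sufficiency\<close>

text \<open>Boundedness is carried along to make the class closed under products, so that polynomial
  components follow from the coordinate functions by introduction rules.\<close>

definition bounded_lipschitz_on :: "'a::metric_space set \<Rightarrow> ('a \<Rightarrow> real) \<Rightarrow> bool" where
  "bounded_lipschitz_on S h \<longleftrightarrow> (\<exists>L. L-lipschitz_on S h) \<and> (\<exists>B. \<forall>x\<in>S. \<bar>h x\<bar> \<le> B)"

named_theorems bounded_lipschitz_intros

lemma bounded_lipschitz_on_const [bounded_lipschitz_intros]: "bounded_lipschitz_on S (\<lambda>x. c)"
  unfolding bounded_lipschitz_on_def using lipschitz_on_constant by blast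

lemma bounded_lipschitz_on_add [bounded_lipschitz_intros]:
  assumes "bounded_lipschitz_on S f" "bounded_lipschitz_on S g"
  shows "bounded_lipschitz_on S (\<lambda>x. f x + g x)"
proof -
  obtain B C where "\<And>x. x \<in> S \<Longrightarrow> \<bar>f x\<bar> \<le> B" "\<And>x. x \<in> S \<Longrightarrow> \<bar>g x\<bar> \<le> C"
    using assms unfolding bounded_lipschitz_on_def by blast
  then have "\<bar>f x + g x\<bar> \<le> B + C" if "x \<in> S" for x
    using that abs_triangle_ineq[of "f x" "g x"] by (meson add_mono order_trans)
  then show ?thesis
    using assms lipschitz_on_add unfolding bounded_lipschitz_on_def by blast
qed

lemma bounded_lipschitz_on_mult [bounded_lipschitz_intros]:
  assumes "bounded_lipschitz_on S f" "bounded_lipschitz_on S g"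
  shows "bounded_lipschitz_on S (\<lambda>x. f x * g x)"
proof -
  obtain B C L M where B: "\<And>x. x \<in> S \<Longrightarrow> \<bar>f x\<bar> \<le> B" and C: "\<And>x. x \<in> S \<Longrightarrow> \<bar>g x\<bar> \<le> C"
    and L: "L-lipschitz_on S f" and M: "M-lipschitz_on S g"
    using assms unfolding bounded_lipschitz_on_def by blast
  have "\<bar>f x * g x\<bar> \<le> \<bar>B\<bar> * \<bar>C\<bar>" if "x \<in> S" for x
    using B[OF that] C[OF that] by (auto simp: abs_mult intro!: mult_mono)
  moreover have "(\<bar>B\<bar> * M + \<bar>C\<bar> * L)-lipschitz_on S (\<lambda>x. f x * g x)"
  proof (rule lipschitz_onI)
    fix x y assume xy: "x \<in> S" "y \<in> S"
    have "f x * g x - f y * g y = f x * (g x - g y) + g y * (f x - f y)"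
      by (simp add: algebra_simps)
    then have "\<bar>f x * g x - f y * g y\<bar> \<le> \<bar>f x\<bar> * \<bar>g x - g y\<bar> + \<bar>g y\<bar> * \<bar>f x - f y\<bar>"
      by (metis abs_mult abs_triangle_ineq)
    also have "\<dots> \<le> \<bar>B\<bar> * (M * dist x y) + \<bar>C\<bar> * (L * dist x y)"
      using B[OF xy(1)] C[OF xy(2)] lipschitz_onD[OF L xy] lipschitz_onD[OF M xy]
      by (intro add_mono mult_mono) (auto simp: dist_real_def)
    finally show "dist (f x * g x) (f y * g y) \<le> (\<bar>B\<bar> * M + \<bar>C\<bar> * L) * dist x y"
      by (simp add: dist_real_def algebra_simps)
  qed (use lipschitz_on_nonneg[OF L] lipschitz_on_nonneg[OF M] in simp)
  ultimately show ?thesis unfolding bounded_lipschitz_on_def by blast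
qed

lemma bounded_lipschitz_on_diff [bounded_lipschitz_intros]:
  assumes "bounded_lipschitz_on S f" "bounded_lipschitz_on S g"
  shows "bounded_lipschitz_on S (\<lambda>x. f x - g x)"
  using bounded_lipschitz_on_add[OF assms(1)
      bounded_lipschitz_on_mult[OF bounded_lipschitz_on_const[of S "-1"] assms(2)]]
  by simp

lemma bounded_lipschitz_on_nth [bounded_lipschitz_intros]:
  assumes "bounded S"
  shows "bounded_lipschitz_on S (\<lambda>x::real^'n. x $ i)"
proof -
  have "1-lipschitz_on S (\<lambda>x. x $ i)"
    by (rule lipschitz_onI) (simp_all add: dist_vec_nth_le)
  moreover have "\<exists>B. \<forall>x\<in>S. \<bar>x $ i\<bar> \<le> B"
    using assms component_le_norm_cart order_trans unfolding bounded_iff by blast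
  ultimately show ?thesis unfolding bounded_lipschitz_on_def by blast
qed

lemma lipschitz_on_vec:
  fixes f :: "'a::metric_space \<Rightarrow> real^'n"
  assumes "\<And>i. bounded_lipschitz_on S (\<lambda>x. f x $ i)"
  shows "\<exists>L. L-lipschitz_on S f"
proof -
  obtain L where L: "\<And>i. (L i)-lipschitz_on S (\<lambda>x. f x $ i)"
    using assms unfolding bounded_lipschitz_on_def by metis
  have "(\<Sum>i\<in>UNIV. L i)-lipschitz_on S f"
  proof (rule lipschitz_onI)
    fix x y assume "x \<in> S" "y \<in> S"
    have "dist (f x) (f y) \<le> (\<Sum>i\<in>UNIV. \<bar>(f x - f y) $ i\<bar>)"
      unfolding dist_norm by (rule norm_le_l1_cart)
    also have "\<dots> \<le> (\<Sum>i\<in>UNIV. L i * dist x y)"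
      using lipschitz_onD[OF L \<open>x \<in> S\<close> \<open>y \<in> S\<close>] by (intro sum_mono) (simp add: dist_real_def)
    finally show "dist (f x) (f y) \<le> (\<Sum>i\<in>UNIV. L i) * dist x y"
      by (simp add: sum_distrib_right)
  qed (simp add: sum_nonneg lipschitz_on_nonneg[OF L])
  then show ?thesis by blast
qed

lemma sphere_field_lipschitz:
  assumes "bounded S"
  shows "\<exists>L. L-lipschitz_on S (sphere_field \<alpha> d)"
proof (rule lipschitz_on_vec)
  fix i :: 3
  show "bounded_lipschitz_on S (\<lambda>x. sphere_field \<alpha> d x $ i)"
    using exhaust_3[of i] assms unfolding sphere_field_def power2_eq_square
    by (auto intro!: bounded_lipschitz_intros)
qed

section \<open>Global forward existence for positive weights\<close>

text \<open>The radial point has distance \<open>norm z - R\<close> from \<open>z\<close>, and by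
  the reverse triangle inequality no point of the ball is nearer.\<close>

lemma closest_point_cball_0:
  fixes z :: "'a::euclidean_space"
  assumes "0 < R" "R < norm z"
  shows "closest_point (cball 0 R) z = (R / norm z) *\<^sub>R z"
proof (rule closest_point_unique[symmetric])
  have "z - (R / norm z) *\<^sub>R z = (1 - R / norm z) *\<^sub>R z"
    by (simp add: algebra_simps)
  then have "dist z ((R / norm z) *\<^sub>R z) = \<bar>1 - R / norm z\<bar> * norm z"
    by (simp add: dist_norm)
  also have "\<dots> = (1 - R / norm z) * norm z"
    using assms by (subst abs_of_nonneg) (auto simp: divide_le_eq_1 simp flip: zero_less_norm_iff)
  also have "\<dots> = norm z - R"
    using assms by (auto simp: left_diff_distrib)
  finally show "\<forall>y\<in>cball 0 R. dist z ((R / norm z) *\<^sub>R z) \<le> dist z y"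
    by (auto simp: dist_norm) (smt (verit) norm_triangle_ineq2)
qed (use assms in auto)

text \<open>Composing the field with the projection to a large ball makes it globally Lipschitz. As the
  field points inwards on the boundary of the ball, the solution never leaves the ball.\<close>

lemma sphere_field_global_solution:
  assumes pos: "\<And>i. 0 < \<alpha> $ i"
  shows "\<exists>x. solves_ode_on (sphere_field \<alpha> d) {0..} x \<and> x 0 = x0"
proof -
  \<comment> \<open>The ball must contain \<open>x0\<close>, and \<open>1 \<le> R\<close> makes
    \<open>1 - x \<bullet> x\<close> nonpositive on its boundary.\<close>
  define R where "R = max 1 (norm x0)"
  define P :: "real^3 \<Rightarrow> real^3" where "P = closest_point (cball 0 R)"
  have R: "1 \<le> R" "norm x0 \<le> R" by (auto simp: R_def)
  have PB: "P z \<in> cball 0 R" for z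
    unfolding P_def using R by (intro closest_point_in_set) auto
  obtain L where L: "L-lipschitz_on (cball 0 R) (sphere_field \<alpha> d)"
    using sphere_field_lipschitz bounded_cball by blast
  have "1-lipschitz_on UNIV P"
    unfolding P_def using R by (intro lipschitz_onI) (auto intro!: closest_point_lipschitz)
  moreover have "L-lipschitz_on (P ` UNIV) (sphere_field \<alpha> d)"
    using L PB by (auto intro: lipschitz_on_subset)
  ultimately have "(L * 1)-lipschitz_on UNIV (\<lambda>z. sphere_field \<alpha> d (P z))"
    by (rule lipschitz_on_compose2)
  then obtain x where x: "solves_ode_on (\<lambda>z. sphere_field \<alpha> d (P z)) {0..} x" and x0: "x 0 = x0"
    using lipschitz_global_solution by blast
  \<comment> \<open>Outside the ball \<open>z\<close> is a positive multiple of the boundary point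
    \<open>P z\<close>, so the sign can be computed at \<open>P z\<close>.\<close>
  have inward: "z \<bullet> sphere_field \<alpha> d (P z) \<le> 0" if "R\<^sup>2 < z \<bullet> z" for z
  proof -
    have nz: "R < norm z"
      using that by (simp add: dot_square_norm power2_less_imp_less)
    then have Pz: "P z = (R / norm z) *\<^sub>R z"
      unfolding P_def using R by (intro closest_point_cball_0) auto
    then have z: "z = (norm z / R) *\<^sub>R P z" and "norm (P z) = R"
      using R nz by auto
    then have "P z \<bullet> P z = R\<^sup>2" by (simp add: dot_square_norm)
    moreover have "1 \<le> R\<^sup>2" using R by (simp add: one_le_power)
    moreover have "0 * (P z \<bullet> P z) \<le> weighted_square \<alpha> (P z)"
      using pos by (intro weighted_square_ge) (simp add: less_imp_le)
    ultimately have "P z \<bullet> sphere_field \<alpha> d (P z) \<le> 0"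
      unfolding inner_sphere_field by (simp add: mult_nonneg_nonpos)
    moreover have "z \<bullet> sphere_field \<alpha> d (P z) = (norm z / R) * (P z \<bullet> sphere_field \<alpha> d (P z))"
      by (metis z inner_scaleR_left)
    moreover have "0 \<le> norm z / R" using R by simp
    ultimately show ?thesis by (metis mult_nonneg_nonpos)
  qed
  have "x t \<bullet> x t \<le> R\<^sup>2" if "0 \<le> t" for t
  proof (rule barrier_bound[OF solves_ode_on_inner[OF x]])
    show "2 * (x s \<bullet> sphere_field \<alpha> d (P (x s))) \<le> 0" if "R\<^sup>2 < x s \<bullet> x s" for s
      using inward[OF that] by simp
    show "x 0 \<bullet> x 0 \<le> R\<^sup>2"
      using R by (simp add: x0 dot_square_norm power_mono)
  qed (use that in auto)
  \<comment> \<open>The projection is the identity inside the ball, so the solution of the truncated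
    equation solves the original one.\<close>
  then have "P (x t) = x t" if "0 \<le> t" for t
    using that R unfolding P_def
    by (intro closest_point_self) (simp add: dot_square_norm abs_le_square_iff[symmetric])
  then have "solves_ode_on (sphere_field \<alpha> d) {0..} x"
    using x unfolding solves_ode_on_def by auto
  then show ?thesis using x0 by blast
qed

section \<open>Exponential convergence to the sphere\<close>

text \<open>Keeping the factor \<open>e\<close> explicit retains the sign of
  \<open>1 - x t \<bullet> x t\<close>. The lemma is used first with \<open>m = 0\<close> to bound
  the solution away from the origin, then with a positive rate.\<close>

lemma sphere_field_decay:
  assumes x: "solves_ode_on (sphere_field \<alpha> d) {0..} x"
    and m: "0 \<le> m" "\<And>s. 0 \<le> s \<Longrightarrow> m \<le> weighted_square \<alpha> (x s)" and "0 \<le> t"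
  obtains e where "0 < e" "e \<le> exp (- 2 * m * t)" "1 - x t \<bullet> x t = (1 - x 0 \<bullet> x 0) * e"
proof -
  define a where "a s = - 2 * weighted_square \<alpha> (x s)" for s
  have "continuous_on {0..t} a"
    unfolding a_def using solves_ode_on_continuous[OF x]
    by (intro continuous_intros) (auto intro: continuous_on_subset)
  then have "integral {0..t} a \<le> integral {0..t} (\<lambda>s. - 2 * m)"
    using m by (intro integral_le integrable_continuous_real) (auto simp: a_def)
  also have "\<dots> = - 2 * m * t" using \<open>0 \<le> t\<close> by simp
  finally show ?thesis
    using one_minus_inner_eq[OF x \<open>0 \<le> t\<close>, folded a_def]
    by (intro that[of "exp (integral {0..t} a)"]) simp_all
qed

lemma sphere_field_tendsto:
  assumes pos: "\<And>i. 0 < \<alpha> $ i" and x: "solves_ode_on (sphere_field \<alpha> d) {0..} x" and "x 0 \<noteq> 0"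
  shows "((\<lambda>t. x t \<bullet> x t) \<longlongrightarrow> 1) at_top"
proof -
  define m where "m = Min (range (\<lambda>i. \<alpha> $ i))"
  have m: "0 < m" "\<And>i. m \<le> \<alpha> $ i"
    using pos by (auto simp: m_def)
  define \<delta> where "\<delta> = min 1 (x 0 \<bullet> x 0)"
  have \<delta>: "0 < \<delta>" using \<open>x 0 \<noteq> 0\<close> by (simp add: \<delta>_def)
  \<comment> \<open>With \<open>e\<close> in (0,1], the value \<open>x t \<bullet> x t\<close> is a
    convex combination of 1 and \<open>x 0 \<bullet> x 0\<close>, hence at least their minimum
    \<open>\<delta>\<close>.\<close>
  have "\<delta> \<le> x t \<bullet> x t" if "0 \<le> t" for t
  proof -
    have "0 \<le> weighted_square \<alpha> y" for y
      using weighted_square_ge[of 0 \<alpha> y] pos by (simp add: less_imp_le)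
    then obtain e where "0 < e" "e \<le> exp (- 2 * 0 * t)" "1 - x t \<bullet> x t = (1 - x 0 \<bullet> x 0) * e"
      using sphere_field_decay[OF x order_refl _ \<open>0 \<le> t\<close>] by metis
    then have e: "0 < e" "e \<le> 1" "1 - x t \<bullet> x t = (1 - x 0 \<bullet> x 0) * e" by auto
    then have "(1 - x 0 \<bullet> x 0) * e \<le> (1 - \<delta>) * e" "(1 - \<delta>) * e \<le> 1 - \<delta>"
      by (auto simp: \<delta>_def mult_left_le)
    then show ?thesis using e(3) by linarith
  qed
  \<comment> \<open>The least weight times the lower bound on the squared norm gives a positive
    decay rate.\<close>
  then have A: "m * \<delta> \<le> weighted_square \<alpha> (x t)" if "0 \<le> t" for t
    using that m weighted_square_ge[OF m(2), of "x t"]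
    by (meson mult_left_mono less_imp_le order_trans)
  have bound: "norm (x t \<bullet> x t - 1) \<le> \<bar>1 - x 0 \<bullet> x 0\<bar> * exp (- 2 * (m * \<delta>) * t)" if "0 \<le> t" for t
  proof -
    have "0 \<le> m * \<delta>" using m \<delta> by simp
    then obtain e where "0 < e" "e \<le> exp (- 2 * (m * \<delta>) * t)"
      "1 - x t \<bullet> x t = (1 - x 0 \<bullet> x 0) * e"
      using sphere_field_decay[OF x _ A \<open>0 \<le> t\<close>] by metis
    then have "\<bar>1 - x t \<bullet> x t\<bar> = \<bar>1 - x 0 \<bullet> x 0\<bar> * e" by (simp add: abs_mult)
    also have "\<dots> \<le> \<bar>1 - x 0 \<bullet> x 0\<bar> * exp (- 2 * (m * \<delta>) * t)"
      by (intro mult_left_mono abs_ge_zero) fact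
    finally show ?thesis by (simp add: abs_minus_commute)
  qed
  have "filterlim (\<lambda>t. - 2 * (m * \<delta>) * t) at_bot at_top"
    using m \<delta> by (intro filterlim_tendsto_neg_mult_at_bot[OF tendsto_const]) (auto simp: filterlim_ident)
  then have "((\<lambda>t. exp (- 2 * (m * \<delta>) * t)) \<longlongrightarrow> 0) at_top"
    by (rule filterlim_compose[OF exp_at_bot])
  then have "((\<lambda>t. \<bar>1 - x 0 \<bullet> x 0\<bar> * exp (- 2 * (m * \<delta>) * t)) \<longlongrightarrow> 0) at_top"
    by (rule tendsto_mult_right_zero)
  then have "((\<lambda>t. x t \<bullet> x t - 1) \<longlongrightarrow> 0) at_top"
    by (rule Lim_null_comparison[rotated])
      (use bound in \<open>auto intro: eventually_mono[OF eventually_ge_at_top[of 0]]\<close>)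
  then show ?thesis by (simp add: LIM_zero_iff)
qed

section \<open>From convergence of the norm to omega-limit sets\<close>

text \<open>The solution is eventually bounded, so compactness of a ball yields a limit point;
  continuity of the inner product puts every limit point on the sphere.\<close>

lemma tendsto_sphere_imp_omega_limit:
  fixes x :: "real \<Rightarrow> 'a::euclidean_space"
  assumes lim: "((\<lambda>t. x t \<bullet> x t) \<longlongrightarrow> 1) at_top"
  shows "omega_limit x \<noteq> {}" and "omega_limit x \<subseteq> sphere 0 1"
proof -
  have "\<forall>\<^sub>F t in at_top. x t \<bullet> x t < 2"
    using lim by (rule order_tendstoD) simp
  then obtain N where N: "\<And>t. N \<le> t \<Longrightarrow> x t \<bullet> x t < 2"
    by (auto simp: eventually_at_top_linorder)
  have "x (N + real n) \<in> cball 0 (sqrt 2)" for n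
    using N[of "N + real n"] by (simp add: norm_eq_sqrt_inner)
  then obtain p and r :: "nat \<Rightarrow> nat"
    where r: "strict_mono r" "((\<lambda>n. x (N + real n)) \<circ> r) \<longlonglongrightarrow> p"
    using compact_cball[of 0 "sqrt 2"] unfolding compact_def by meson
  have "filterlim (\<lambda>n. N + real (r n)) at_top sequentially"
    using filterlim_subseq[OF r(1)]
    by (intro filterlim_tendsto_add_at_top[OF tendsto_const]
        filterlim_compose[OF filterlim_real_sequentially])
  then have "p \<in> omega_limit x"
    using r(2) unfolding omega_limit_def by (auto simp: o_def)
  then show "omega_limit x \<noteq> {}" by blast
  show "omega_limit x \<subseteq> sphere 0 1"
  proof
    fix p assume "p \<in> omega_limit x"
    then obtain \<tau> where "filterlim \<tau> at_top sequentially"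
      and "(\<lambda>n. x (\<tau> n) \<bullet> x (\<tau> n)) \<longlonglongrightarrow> p \<bullet> p"
      by (rule omega_limit_inner)
    then have "p \<bullet> p = 1"
      using filterlim_compose[OF lim] LIMSEQ_unique by blast
    then show "p \<in> sphere 0 1" unfolding mem_unit_sphere_iff by simp
  qed
qed

theorem theorem2p4:
  fixes \<alpha> d :: "real^3"
  shows "invariant_set (sphere_field \<alpha> d) (sphere 0 1) \<and>
    (global_attractor_in (sphere_field \<alpha> d) (sphere 0 1) (UNIV - {0}) \<longleftrightarrow> (\<forall>i. \<alpha> $ i > 0))"
proof (intro conjI iffI allI)
  show "invariant_set (sphere_field \<alpha> d) (sphere 0 1)"
    by (rule sphere_field_invariant)
  show "0 < \<alpha> $ i"
    if "global_attractor_in (sphere_field \<alpha> d) (sphere 0 1) (UNIV - {0})" for i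
    using that by (rule attractor_imp_pos)
  \<comment> \<open>Existence provides one global solution from each starting point; the convergence
    lemmas cover every such solution.\<close>
  show "global_attractor_in (sphere_field \<alpha> d) (sphere 0 1) (UNIV - {0})" if "\<forall>i. \<alpha> $ i > 0"
    unfolding global_attractor_in_def
    using that sphere_field_global_solution sphere_field_tendsto tendsto_sphere_imp_omega_limit
    by (metis DiffE singletonI)
qed

end
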